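(* If $X$ is a topological space and $T[X,\$]$ (the set $\mathcal{O}_X$ of open subsets of $X$ with the Scott topology) is core compact, then $X$ is infraconsonant.
   Context: For a topological space $X$, $\mathcal{O}_X$ is the set of open subsets of $X$, ordered by inclusion. $T[X,\$]$ denotes $\mathcal{O}_X$ endowed with the Scott topology: its open sets are the families $\mathcal{A}\subseteq\mathcal{O}_X$ closed under open supersets and such that whenever $\bigcup_{i\in I}O_i\in\mathcal{A}$ with each $O_i$ open, there is a finite $J\subseteq I$ with $\bigcup_{i\in J}O_i\in\mathcal{A}$. A topological space $Y$ is core compact if for every $y\in Y$ and every open set $O$ containing $y$ there is an open set $U$ containing $y$ such that every open cover of $O$ has a finite subfamily that covers $U$. A topological space $X$ is infraconsonant if for every nonempty Scott open subset $\mathcal{A}$ of $\mathcal{O}_X$ there is a nonempty Scott open subset $\mathcal{C}$ of $\mathcal{O}_X$ such that $\mathcal{C}\vee\mathcal{C}\subseteq\mathcal{A}$, where $\mathcal{C}\vee\mathcal{C}:=\{C\cap D:C,D\in\mathcal{C}\}$. *)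

theory Defs
  imports "HOL-Analysis.Analysis"
begin

definition scott_open :: "'a topology \<Rightarrow> 'a set set \<Rightarrow> bool" where
  "scott_open X \<A> \<longleftrightarrow>
     (\<forall>U\<in>\<A>. openin X U) \<and>
     (\<forall>U V. U \<in> \<A> \<and> openin X V \<and> U \<subseteq> V \<longrightarrow> V \<in> \<A>) \<and>
     (\<forall>\<U>. (\<forall>U\<in>\<U>. openin X U) \<and> \<Union>\<U> \<in> \<A> \<longrightarrow>
        (\<exists>\<F>. finite \<F> \<and> \<F> \<subseteq> \<U> \<and> \<Union>\<F> \<in> \<A>))"

definition scott_topology :: "'a topology \<Rightarrow> 'a set topology" where
  "scott_topology X = topology (scott_open X)"

lemma scott_open_openin: "scott_open X \<A> \<Longrightarrow> U \<in> \<A> \<Longrightarrow> openin X U"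
  unfolding scott_open_def by (elim conjE) (erule bspec)

lemma scott_open_superset:
  "scott_open X \<A> \<Longrightarrow> U \<in> \<A> \<Longrightarrow> openin X V \<Longrightarrow> U \<subseteq> V \<Longrightarrow> V \<in> \<A>"
  unfolding scott_open_def by (elim conjE allE[of _ U] allE[of _ V]) (rule mp, assumption, intro conjI)

lemma scott_open_finite:
  assumes "scott_open X \<A>" and "\<forall>U\<in>\<U>. openin X U" and "\<Union>\<U> \<in> \<A>"
  obtains \<F> where "finite \<F>" "\<F> \<subseteq> \<U>" "\<Union>\<F> \<in> \<A>"
proof -
  have "\<exists>\<F>. finite \<F> \<and> \<F> \<subseteq> \<U> \<and> \<Union>\<F> \<in> \<A>"
    using assms(1)[unfolded scott_open_def, THEN conjunct2, THEN conjunct2, rule_format, of \<U>]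
      assms(2,3) by simp
  then show thesis using that by (elim exE conjE) assumption
qed

lemma scott_open_Int:
  assumes "scott_open X \<A>" and "scott_open X \<B>"
  shows "scott_open X (\<A> \<inter> \<B>)"
  unfolding scott_open_def
proof (intro conjI allI impI)
  show "\<forall>U\<in>\<A> \<inter> \<B>. openin X U"
    using scott_open_openin[OF assms(1)] by simp
next
  fix U V assume "U \<in> \<A> \<inter> \<B> \<and> openin X V \<and> U \<subseteq> V"
  then show "V \<in> \<A> \<inter> \<B>"
    using scott_open_superset[OF assms(1), of U V] scott_open_superset[OF assms(2), of U V] by simp
next
  fix \<U> assume U: "(\<forall>U\<in>\<U>. openin X U) \<and> \<Union>\<U> \<in> \<A> \<inter> \<B>"
  then have op: "\<forall>U\<in>\<U>. openin X U" and mem: "\<Union>\<U> \<in> \<A>" "\<Union>\<U> \<in> \<B>"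
    by simp_all
  obtain F where F: "finite F" "F \<subseteq> \<U>" "\<Union>F \<in> \<A>"
    using scott_open_finite[OF assms(1) op mem(1)] .
  obtain G where G: "finite G" "G \<subseteq> \<U>" "\<Union>G \<in> \<B>"
    using scott_open_finite[OF assms(2) op mem(2)] .
  have FG: "F \<union> G \<subseteq> \<U>" using F(2) G(2) by (rule Un_least)
  have opFG: "openin X (\<Union>(F \<union> G))"
    by (rule openin_Union, rule bspec[OF op], rule subsetD[OF FG])
  have "\<Union>(F \<union> G) \<in> \<A>" "\<Union>(F \<union> G) \<in> \<B>"
    by (rule scott_open_superset[OF assms(1) F(3) opFG], simp)
      (rule scott_open_superset[OF assms(2) G(3) opFG], simp)
  then show "\<exists>\<F>. finite \<F> \<and> \<F> \<subseteq> \<U> \<and> \<Union>\<F> \<in> \<A> \<inter> \<B>"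
    using F(1) G(1) FG by (intro exI[of _ "F \<union> G"]) simp
qed

lemma scott_open_Union:
  assumes "\<And>\<A>. \<A> \<in> \<K> \<Longrightarrow> scott_open X \<A>"
  shows "scott_open X (\<Union>\<K>)"
  unfolding scott_open_def
proof (intro conjI allI impI)
  show "\<forall>U\<in>\<Union>\<K>. openin X U"
    using scott_open_openin[OF assms] by (intro ballI) (erule UnionE)
next
  fix U V assume UV: "U \<in> \<Union>\<K> \<and> openin X V \<and> U \<subseteq> V"
  then obtain \<A> where A: "\<A> \<in> \<K>" "U \<in> \<A>" by (elim conjE UnionE)
  show "V \<in> \<Union>\<K>"
    using scott_open_superset[OF assms[OF A(1)] A(2), of V] UV A(1) by (intro UnionI[of \<A>]) simp_all
next
  fix \<U> assume U: "(\<forall>U\<in>\<U>. openin X U) \<and> \<Union>\<U> \<in> \<Union>\<K>"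
  then obtain \<A> where A: "\<A> \<in> \<K>" "\<Union>\<U> \<in> \<A>" by (elim conjE UnionE)
  obtain F where F: "finite F" "F \<subseteq> \<U>" "\<Union>F \<in> \<A>"
    using scott_open_finite[OF assms[OF A(1)] conjunct1[OF U] A(2)] .
  show "\<exists>\<F>. finite \<F> \<and> \<F> \<subseteq> \<U> \<and> \<Union>\<F> \<in> \<Union>\<K>"
    by (intro exI[of _ F] conjI F(1,2) UnionI[OF A(1) F(3)])
qed

lemma istopology_scott_open: "istopology (scott_open X)"
  unfolding istopology_def by (intro conjI allI impI scott_open_Int scott_open_Union) simp_all

lemma openin_scott_topology [simp]: "openin (scott_topology X) = scott_open X"
  unfolding scott_topology_def by (rule topology_inverse'[OF istopology_scott_open])

lemma topspace_scott_topology [simp]: "topspace (scott_topology X) = {U. openin X U}"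
proof
  have "openin (scott_topology X) {U. openin X U}"
    unfolding openin_scott_topology scott_open_def
  proof (intro conjI allI impI)
    fix \<U> :: "'a set set"
    show "\<exists>\<F>. finite \<F> \<and> \<F> \<subseteq> \<U> \<and> \<Union>\<F> \<in> {U. openin X U}"
      by (rule exI[of _ "{}"]) simp
  qed simp_all
  then show "{U. openin X U} \<subseteq> topspace (scott_topology X)"
    by (rule openin_subset)
next
  have "scott_open X (topspace (scott_topology X))"
    using openin_topspace[of "scott_topology X"] by simp
  then show "topspace (scott_topology X) \<subseteq> {U. openin X U}"
    using scott_open_openin by (intro subsetI CollectI)
qed

definition core_compact_space :: "'a topology \<Rightarrow> bool" where
  "core_compact_space Y \<longleftrightarrow>
     (\<forall>y\<in>topspace Y. \<forall>W. openin Y W \<and> y \<in> W \<longrightarrow>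
        (\<exists>U. openin Y U \<and> y \<in> U \<and>
           (\<forall>\<V>. (\<forall>V\<in>\<V>. openin Y V) \<and> W \<subseteq> \<Union>\<V> \<longrightarrow>
              (\<exists>\<F>. finite \<F> \<and> \<F> \<subseteq> \<V> \<and> U \<subseteq> \<Union>\<F>))))"

definition pairwise_meets :: "'a set set \<Rightarrow> 'a set set \<Rightarrow> 'a set set" where
  "pairwise_meets \<C> \<D> = {C \<inter> D | C D. C \<in> \<C> \<and> D \<in> \<D>}"

definition infraconsonant_space :: "'a topology \<Rightarrow> bool" where
  "infraconsonant_space X \<longleftrightarrow>
     (\<forall>\<A>. openin (scott_topology X) \<A> \<and> \<A> \<noteq> {} \<longrightarrow>
        (\<exists>\<C>. openin (scott_topology X) \<C> \<and> \<C> \<noteq> {} \<and> pairwise_meets \<C> \<C> \<subseteq> \<A>))"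

end

theory Submission
  imports Defs
begin

text \<open>
  Intersection of open sets is Scott continuous as a map of two variables, because open sets form
  a frame. Infraconsonance asks for more: that the preimage
  \<open>{(U, V). U \<inter> V \<in> \<A>}\<close> of a Scott open \<open>\<A>\<close> be a neighbourhood of
  \<open>(topspace X, topspace X)\<close> in the \<^emph>\<open>product\<close> of the two Scott topologies, which in general
  is coarser than the Scott topology of the product order. Core compactness of one factor closes
  this gap. The preimage has Scott open sections \<open>{U. U \<inter> V \<in> \<A>}\<close>, and the section at
  \<open>\<Union>\<V>\<close> is the directed union of the sections at \<open>\<Union>\<F>\<close> with \<open>\<F> \<subseteq> \<V>\<close> finite
  (\<open>meet_section_Union\<close>). Choose a neighbourhood \<open>\<U>\<close> of \<open>topspace X\<close> way below the section
  at \<open>topspace X\<close>, which is \<open>\<A>\<close>. In a core compact space the way-below relation interpolates,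
  so being way above \<open>\<U>\<close> is inaccessible by directed unions (\<open>way_below_directed_Union\<close>);
  hence the \<open>V\<close> whose section is way above \<open>\<U>\<close> form a Scott open family \<open>\<B>\<close>
  (\<open>scott_open_way_above_sections\<close>). Then \<open>\<U> \<times> \<B>\<close> is the required open rectangle, and
  \<open>\<U> \<inter> \<B>\<close> witnesses infraconsonance.
\<close>

definition way_below :: "'b topology \<Rightarrow> 'b set \<Rightarrow> 'b set \<Rightarrow> bool" where
  "way_below Y U W \<longleftrightarrow>
     (\<forall>\<V>. (\<forall>V\<in>\<V>. openin Y V) \<and> W \<subseteq> \<Union>\<V> \<longrightarrow>
        (\<exists>\<F>. finite \<F> \<and> \<F> \<subseteq> \<V> \<and> U \<subseteq> \<Union>\<F>))"

lemma way_belowE: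
  assumes "way_below Y U W" "\<And>V. V \<in> \<V> \<Longrightarrow> openin Y V" "W \<subseteq> \<Union>\<V>"
  obtains \<F> where "finite \<F>" "\<F> \<subseteq> \<V>" "U \<subseteq> \<Union>\<F>"
proof -
  have "\<exists>\<F>. finite \<F> \<and> \<F> \<subseteq> \<V> \<and> U \<subseteq> \<Union>\<F>"
    using assms(1)[unfolded way_below_def, rule_format, of \<V>] assms(2,3) by simp
  then show thesis using that by (elim exE conjE)
qed

lemma core_compact_spaceE:
  assumes "core_compact_space Y" "openin Y W" "y \<in> W"
  obtains U where "openin Y U" "y \<in> U" "way_below Y U W"
proof -
  have "y \<in> topspace Y"
    using assms(2,3) openin_subset by blast
  with assms show thesis
    using that unfolding core_compact_space_def way_below_def by blast
qed

lemma way_below_imp_subset: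
  assumes "way_below Y U W" "openin Y W"
  shows "U \<subseteq> W"
proof -
  obtain \<F> where "\<F> \<subseteq> {W}" "U \<subseteq> \<Union>\<F>"
    by (rule way_belowE[OF assms(1), of "{W}"]) (simp_all add: assms(2))
  then show ?thesis by blast
qed

lemma way_below_mono:
  assumes "way_below Y U W" "U' \<subseteq> U" "W \<subseteq> W'"
  shows "way_below Y U' W'"
  unfolding way_below_def
proof (intro allI impI)
  fix \<V> assume \<V>: "(\<forall>V\<in>\<V>. openin Y V) \<and> W' \<subseteq> \<Union>\<V>"
  have "W \<subseteq> \<Union>\<V>"
    by (rule subset_trans[OF assms(3) conjunct2[OF \<V>]])
  then obtain \<F> where "finite \<F>" "\<F> \<subseteq> \<V>" "U \<subseteq> \<Union>\<F>"
    using \<V> way_belowE[OF assms(1), of \<V>] by metis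
  then show "\<exists>\<F>. finite \<F> \<and> \<F> \<subseteq> \<V> \<and> U' \<subseteq> \<Union>\<F>"
    using assms(2) by (intro exI[of _ \<F>]) blast
qed

lemma way_below_finite_Union:
  assumes "finite \<G>" "\<And>U. U \<in> \<G> \<Longrightarrow> way_below Y U W"
  shows "way_below Y (\<Union>\<G>) W"
  unfolding way_below_def
proof (intro allI impI)
  fix \<V> assume \<V>: "(\<forall>V\<in>\<V>. openin Y V) \<and> W \<subseteq> \<Union>\<V>"
  have "\<forall>U\<in>\<G>. \<exists>\<F>. finite \<F> \<and> \<F> \<subseteq> \<V> \<and> U \<subseteq> \<Union>\<F>"
    using assms(2)[unfolded way_below_def, rule_format, OF _ \<V>[simplified]] by simp
  then obtain \<phi> where \<phi>: "\<And>U. U \<in> \<G> \<Longrightarrow> finite (\<phi> U) \<and> \<phi> U \<subseteq> \<V> \<and> U \<subseteq> \<Union>(\<phi> U)"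
    by metis
  show "\<exists>\<F>. finite \<F> \<and> \<F> \<subseteq> \<V> \<and> \<Union>\<G> \<subseteq> \<Union>\<F>"
  proof (intro exI conjI)
    show "finite (\<Union>(\<phi> ` \<G>))" using assms(1) \<phi> by simp
    show "\<Union>(\<phi> ` \<G>) \<subseteq> \<V>" using \<phi> by (simp add: UN_least)
    have "U \<subseteq> \<Union>(\<Union>(\<phi> ` \<G>))" if "U \<in> \<G>" for U
      using conjunct2[OF conjunct2[OF \<phi>[OF that]]] that by blast
    then show "\<Union>\<G> \<subseteq> \<Union>(\<Union>(\<phi> ` \<G>))" by (rule Union_least)
  qed
qed

text \<open>
  The defining property of way-below only puts \<open>U\<close> inside some member of a directed cover. In a
  core compact space each member is itself the union of the open sets way below it; applying the
  covering property to this finer cover puts \<open>U\<close> inside a finite union of sets way below members,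
  and directedness merges these members into one.
\<close>
lemma way_below_directed_Union:
  assumes "core_compact_space Y"
    and open_W: "\<And>W. W \<in> \<W> \<Longrightarrow> openin Y W"
    and directed: "\<And>\<F>. finite \<F> \<Longrightarrow> \<F> \<subseteq> \<W> \<Longrightarrow> \<exists>W\<in>\<W>. \<Union>\<F> \<subseteq> W"
    and "way_below Y U (\<Union>\<W>)"
  obtains W where "W \<in> \<W>" "way_below Y U W"
proof -
  define \<V> where "\<V> = {V. openin Y V \<and> (\<exists>W\<in>\<W>. way_below Y V W)}"
  have "\<Union>\<W> \<subseteq> \<Union>\<V>"
  proof
    fix y assume "y \<in> \<Union>\<W>"
    then obtain W where W: "W \<in> \<W>" "y \<in> W" by blast
    then obtain V where "openin Y V" "y \<in> V" "way_below Y V W"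
      using core_compact_spaceE[OF assms(1) open_W] by blast
    with W show "y \<in> \<Union>\<V>" unfolding \<V>_def by blast
  qed
  moreover have "openin Y V" if "V \<in> \<V>" for V
    using that by (simp add: \<V>_def)
  ultimately obtain \<G> where \<G>: "finite \<G>" "\<G> \<subseteq> \<V>" "U \<subseteq> \<Union>\<G>"
    using way_belowE[OF assms(4), of \<V>] by metis
  have "\<forall>V\<in>\<G>. \<exists>W\<in>\<W>. way_below Y V W"
    using \<G>(2) unfolding \<V>_def by blast
  then obtain \<omega> where \<omega>: "\<And>V. V \<in> \<G> \<Longrightarrow> \<omega> V \<in> \<W> \<and> way_below Y V (\<omega> V)"
    by metis
  obtain W where W: "W \<in> \<W>" "\<Union>(\<omega> ` \<G>) \<subseteq> W"
    using directed[of "\<omega> ` \<G>"] \<G>(1) \<omega> by blast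
  have "way_below Y V W" if "V \<in> \<G>" for V
    using way_below_mono[of Y V "\<omega> V" V W] \<omega>[OF that] W(2) that by blast
  then have "way_below Y (\<Union>\<G>) W"
    by (rule way_below_finite_Union[OF \<G>(1)])
  then show thesis
    using that W(1) way_below_mono[OF _ \<G>(3) subset_refl] by blast
qed

definition meet_section :: "'a topology \<Rightarrow> 'a set set \<Rightarrow> 'a set \<Rightarrow> 'a set set" where
  "meet_section X \<A> V = {U. openin X U \<and> U \<inter> V \<in> \<A>}"

lemma meet_section_mono:
  assumes "scott_open X \<A>" "V \<subseteq> V'" "openin X V'"
  shows "meet_section X \<A> V \<subseteq> meet_section X \<A> V'"
proof
  fix U assume "U \<in> meet_section X \<A> V"
  then have U: "openin X U" "U \<inter> V \<in> \<A>" by (simp_all add: meet_section_def)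
  have "U \<inter> V' \<in> \<A>"
    using scott_open_superset[OF assms(1) U(2)] U(1) assms(2,3) by blast
  with U(1) show "U \<in> meet_section X \<A> V'" by (simp add: meet_section_def)
qed

text \<open>
  Both this lemma and the next rest on the frame law \<open>U \<inter> \<Union>\<V> = (\<Union>V\<in>\<V>. U \<inter> V)\<close>, which says
  that intersection preserves unions in each variable; a finite subfamily of the right-hand side
  comes from a finite subfamily of \<open>\<V>\<close>.
\<close>
lemma scott_open_finite_Int_Union:
  assumes "scott_open X \<A>" "openin X U" "\<And>V. V \<in> \<V> \<Longrightarrow> openin X V" "U \<inter> \<Union>\<V> \<in> \<A>"
  obtains \<F> where "finite \<F>" "\<F> \<subseteq> \<V>" "U \<inter> \<Union>\<F> \<in> \<A>"
proof -
  have "\<forall>V\<in>(\<inter>) U ` \<V>. openin X V"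
    using assms(2,3) by (simp add: openin_Int)
  moreover have "\<Union>((\<inter>) U ` \<V>) \<in> \<A>" using assms(4) by (simp only: Int_Union)
  ultimately obtain \<G> where \<G>: "finite \<G>" "\<G> \<subseteq> (\<inter>) U ` \<V>" "\<Union>\<G> \<in> \<A>"
    by (rule scott_open_finite[OF assms(1)])
  then obtain \<F> where \<F>: "finite \<F>" "\<F> \<subseteq> \<V>" "\<G> = (\<inter>) U ` \<F>"
    using finite_subset_image[of \<G> "(\<inter>) U" \<V>] by blast
  with \<G>(3) have "U \<inter> \<Union>\<F> \<in> \<A>" by (simp only: Int_Union)
  with \<F> that show thesis by blast
qed

lemma scott_open_meet_section:
  assumes "scott_open X \<A>" "openin X V"
  shows "scott_open X (meet_section X \<A> V)"
  unfolding scott_open_def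
proof (intro conjI allI impI)
  show "\<forall>U\<in>meet_section X \<A> V. openin X U" by (simp add: meet_section_def)
next
  fix U U' assume U: "U \<in> meet_section X \<A> V \<and> openin X U' \<and> U \<subseteq> U'"
  then have "U \<inter> V \<in> \<A>" "openin X (U' \<inter> V)" "U \<inter> V \<subseteq> U' \<inter> V"
    using assms(2) by (auto simp: meet_section_def)
  then have "U' \<inter> V \<in> \<A>" by (rule scott_open_superset[OF assms(1)])
  with U show "U' \<in> meet_section X \<A> V" by (simp add: meet_section_def)
next
  fix \<U> assume \<U>: "(\<forall>U\<in>\<U>. openin X U) \<and> \<Union>\<U> \<in> meet_section X \<A> V"
  then have "V \<inter> \<Union>\<U> \<in> \<A>" by (simp add: meet_section_def Int_commute)
  then obtain \<F> where \<F>: "finite \<F>" "\<F> \<subseteq> \<U>" "V \<inter> \<Union>\<F> \<in> \<A>"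
    using scott_open_finite_Int_Union[OF assms(1,2), of \<U>] \<U> by blast
  moreover have "openin X (\<Union>\<F>)" using \<F>(2) \<U> by blast
  ultimately show "\<exists>\<F>. finite \<F> \<and> \<F> \<subseteq> \<U> \<and> \<Union>\<F> \<in> meet_section X \<A> V"
    by (auto simp: meet_section_def Int_commute)
qed

lemma meet_section_Union:
  assumes "scott_open X \<A>" "\<And>V. V \<in> \<V> \<Longrightarrow> openin X V"
  shows "meet_section X \<A> (\<Union>\<V>) = (\<Union>\<F>\<in>{\<F>. finite \<F> \<and> \<F> \<subseteq> \<V>}. meet_section X \<A> (\<Union>\<F>))"
proof (intro subset_antisym subsetI)
  fix U assume "U \<in> meet_section X \<A> (\<Union>\<V>)"
  then have U: "openin X U" "U \<inter> \<Union>\<V> \<in> \<A>" by (simp_all add: meet_section_def)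
  obtain \<F> where "finite \<F>" "\<F> \<subseteq> \<V>" "U \<inter> \<Union>\<F> \<in> \<A>"
    by (rule scott_open_finite_Int_Union[OF assms(1) U(1) assms(2) U(2)])
  then show "U \<in> (\<Union>\<F>\<in>{\<F>. finite \<F> \<and> \<F> \<subseteq> \<V>}. meet_section X \<A> (\<Union>\<F>))"
    using U(1) by (auto simp: meet_section_def)
next
  fix U assume "U \<in> (\<Union>\<F>\<in>{\<F>. finite \<F> \<and> \<F> \<subseteq> \<V>}. meet_section X \<A> (\<Union>\<F>))"
  then obtain \<F> where "\<F> \<subseteq> \<V>" "U \<in> meet_section X \<A> (\<Union>\<F>)" by blast
  then show "U \<in> meet_section X \<A> (\<Union>\<V>)"
    using meet_section_mono[OF assms(1) Union_mono openin_Union] assms(2) by blast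
qed

text \<open>
  The map \<open>V \<mapsto> meet_section X \<A> V\<close> preserves directed unions, and the open sets way above
  \<open>\<U>\<close> form a Scott open family; this is the preimage of that family.
\<close>
lemma scott_open_way_above_sections:
  assumes cc: "core_compact_space (scott_topology X)" and \<A>: "scott_open X \<A>"
  shows "scott_open X {V. openin X V \<and> way_below (scott_topology X) \<U> (meet_section X \<A> V)}"
    (is "scott_open X ?\<B>")
  unfolding scott_open_def
proof (intro conjI allI impI)
  show "\<forall>V\<in>?\<B>. openin X V" by simp
next
  fix V V' assume "V \<in> ?\<B> \<and> openin X V' \<and> V \<subseteq> V'"
  then show "V' \<in> ?\<B>"
    using way_below_mono[OF _ subset_refl meet_section_mono[OF \<A>]] by blast
next
  fix \<V> assume \<V>: "(\<forall>V\<in>\<V>. openin X V) \<and> \<Union>\<V> \<in> ?\<B>"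
  define \<W> where "\<W> = (\<lambda>\<F>. meet_section X \<A> (\<Union>\<F>)) ` {\<F>. finite \<F> \<and> \<F> \<subseteq> \<V>}"
  have open_Un: "openin X (\<Union>\<F>)" if "\<F> \<subseteq> \<V>" for \<F>
    using that \<V> by blast
  have "way_below (scott_topology X) \<U> (\<Union>\<W>)"
    using \<V> meet_section_Union[OF \<A>, of \<V>] by (simp add: \<W>_def)
  moreover have "openin (scott_topology X) W" if "W \<in> \<W>" for W
    using that scott_open_meet_section[OF \<A> open_Un] by (auto simp: \<W>_def)
  moreover have "\<exists>W\<in>\<W>. \<Union>\<G> \<subseteq> W" if \<G>: "finite \<G>" "\<G> \<subseteq> \<W>" for \<G>
  proof -
    obtain K where K: "finite K" "K \<subseteq> {\<F>. finite \<F> \<and> \<F> \<subseteq> \<V>}"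
      "\<G> = (\<lambda>\<F>. meet_section X \<A> (\<Union>\<F>)) ` K"
      using finite_subset_image[OF \<G>(1) \<G>(2)[unfolded \<W>_def]] by blast
    have fin: "finite (\<Union>K)" and sub: "\<Union>K \<subseteq> \<V>" using K(1,2) by blast+
    have "meet_section X \<A> (\<Union>\<F>) \<subseteq> meet_section X \<A> (\<Union>(\<Union>K))" if "\<F> \<in> K" for \<F>
      using that by (intro meet_section_mono[OF \<A> _ open_Un[OF sub]]) blast
    then have "\<Union>\<G> \<subseteq> meet_section X \<A> (\<Union>(\<Union>K))" using K(3) by blast
    moreover have "meet_section X \<A> (\<Union>(\<Union>K)) \<in> \<W>"
      using fin sub by (auto simp only: \<W>_def)
    ultimately show ?thesis by blast
  qed
  ultimately obtain W where "W \<in> \<W>" "way_below (scott_topology X) \<U> W"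
    using way_below_directed_Union[OF cc, of \<W> \<U>] by metis
  then show "\<exists>\<F>. finite \<F> \<and> \<F> \<subseteq> \<V> \<and> \<Union>\<F> \<in> ?\<B>"
    using open_Un by (auto simp: \<W>_def)
qed

theorem theorem9:
  fixes X :: "'a topology"
  assumes "core_compact_space (scott_topology X)"
  shows "infraconsonant_space X"
  unfolding infraconsonant_space_def
proof (intro allI impI)
  fix \<A> assume "openin (scott_topology X) \<A> \<and> \<A> \<noteq> {}"
  then have \<A>: "scott_open X \<A>" "\<A> \<noteq> {}" by simp_all
  have top: "topspace X \<in> \<A>"
    using \<A> scott_open_superset[OF \<A>(1)] scott_open_openin[OF \<A>(1)] openin_subset by blast
  have "U \<inter> topspace X = U" if "openin X U" for U
    using openin_subset[OF that] by blast
  then have section_top: "meet_section X \<A> (topspace X) = \<A>"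
    using scott_open_openin[OF \<A>(1)] by (auto simp: meet_section_def)
  obtain \<U> where \<U>: "scott_open X \<U>" "topspace X \<in> \<U>" "way_below (scott_topology X) \<U> \<A>"
    using core_compact_spaceE[OF assms, of \<A> "topspace X"] \<A>(1) top by auto
  define \<B> where
    "\<B> = {V. openin X V \<and> way_below (scott_topology X) \<U> (meet_section X \<A> V)}"
  have "scott_open X \<B>"
    unfolding \<B>_def by (rule scott_open_way_above_sections[OF assms \<A>(1)])
  then have "scott_open X (\<U> \<inter> \<B>)" by (rule scott_open_Int[OF \<U>(1)])
  moreover have "topspace X \<in> \<U> \<inter> \<B>"
    using \<U>(2,3) section_top by (simp add: \<B>_def)
  moreover have "pairwise_meets (\<U> \<inter> \<B>) (\<U> \<inter> \<B>) \<subseteq> \<A>"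
  proof -
    have "C \<inter> D \<in> \<A>" if "C \<in> \<U>" "D \<in> \<B>" for C D
    proof -
      have "\<U> \<subseteq> meet_section X \<A> D"
        using that(2) scott_open_meet_section[OF \<A>(1)]
        by (intro way_below_imp_subset[of "scott_topology X"]) (simp_all add: \<B>_def)
      with that(1) show ?thesis by (auto simp: meet_section_def)
    qed
    then show ?thesis by (auto simp: pairwise_meets_def)
  qed
  ultimately show "\<exists>\<C>. openin (scott_topology X) \<C> \<and> \<C> \<noteq> {} \<and> pairwise_meets \<C> \<C> \<subseteq> \<A>"
    by auto
qed

end
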